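(* Every finite tangled closure algebra $(A,\mathbf{C}^t_A)$ is isomorphic (as a tangled closure algebra) to $(A_S,\mathbf{C}^t_R)$ for some finite quasi-ordered set $(S,R)$.
   Context: A Boolean algebra $A$ has operations $\land,\lor,-,0,1$; $a\Rightarrow b=-a\lor b$. A closure operator on $A$ is $\mathbf{C}:A\to A$ with $\mathbf{C}(a\lor b)=\mathbf{C}a\lor\mathbf{C}b$, $\mathbf{C}0=0$, $a\leq\mathbf{C}a=\mathbf{C}\mathbf{C}a$; interior $\mathbf{I}a=-\mathbf{C}-a$. $\mathcal{P}_{fin}A$ is the set of finite non-empty subsets of $A$. For $\mathbf{C}^t:\mathcal{P}_{fin}A\to A$, the induced $\mathbf{C}a=\mathbf{C}^t\{a\}$, $\mathbf{I}a=-\mathbf{C}^t\{-a\}$; $(A,\mathbf{C}^t)$ is a tangled closure algebra if $\mathbf{C}$ is a closure operator and for all $\varGamma\in\mathcal{P}_{fin}A$, $a\in A$: (Fix) $\mathbf{C}^t\varGamma\leq\bigwedge_{\gamma\in\varGamma}\mathbf{C}(\gamma\land\mathbf{C}^t\varGamma)$; (Ind) $\mathbf{I}(a\Rightarrow\bigwedge_{\gamma\in\varGamma}\mathbf{C}(\gamma\land a))\land a\leq\mathbf{C}^t\varGamma$. An isomorphism of tangled closure algebras is a Boolean isomorphism $f$ with $f(\mathbf{C}^t_A\varGamma)=\mathbf{C}^t_B\{f\gamma:\gamma\in\varGamma\}$. For a quasi-ordered set $(S,R)$ ($R$ reflexive and transitive), $A_S$ is the powerset Boolean algebra of $S$, $\mathbf{C}_R(a)=R^{-1}(a)=\{x:\exists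 y\,(xRy\text{ and }y\in a)\}$, and $\mathbf{C}^t_R\varGamma=\bigcup\{a\subseteq S: a\subseteq\bigcap_{\gamma\in\varGamma}R^{-1}(\gamma\cap a)\}$. *)

theory Defs
  imports Main
begin

definition closure_operator :: "('a::boolean_algebra \<Rightarrow> 'a) \<Rightarrow> bool" where
  "closure_operator C \<longleftrightarrow>
     (\<forall>a b. C (sup a b) = sup (C a) (C b)) \<and>
     C bot = bot \<and>
     (\<forall>a. a \<le> C a \<and> C a = C (C a))"

definition bimp :: "'a::boolean_algebra \<Rightarrow> 'a \<Rightarrow> 'a" where
  "bimp a b = sup (- a) b"

definition Pfin :: "'a set \<Rightarrow> 'a set set" where
  "Pfin A = {\<Gamma>. \<Gamma> \<subseteq> A \<and> finite \<Gamma> \<and> \<Gamma> \<noteq> {}}"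

text \<open>A map on the finite non-empty subsets of \<open>'a\<close> is represented by a total function on
  \<open>'a set\<close>; its values outside \<open>Pfin UNIV\<close> are irrelevant in everything below.\<close>

definition ind_closure :: "('a::boolean_algebra set \<Rightarrow> 'a) \<Rightarrow> 'a \<Rightarrow> 'a" where
  "ind_closure Ct a = Ct {a}"

definition ind_interior :: "('a::boolean_algebra set \<Rightarrow> 'a) \<Rightarrow> 'a \<Rightarrow> 'a" where
  "ind_interior Ct a = - Ct {- a}"

locale tangled_closure_algebra =
  fixes Ct :: "'a::boolean_algebra set \<Rightarrow> 'a"
  assumes closure: "closure_operator (ind_closure Ct)"
    and Fix: "\<Gamma> \<in> Pfin UNIV \<Longrightarrow>
      Ct \<Gamma> \<le> Inf_fin ((\<lambda>\<gamma>. ind_closure Ct (inf \<gamma> (Ct \<Gamma>))) ` \<Gamma>)"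
    and Ind: "\<Gamma> \<in> Pfin UNIV \<Longrightarrow>
      inf (ind_interior Ct (bimp a (Inf_fin ((\<lambda>\<gamma>. ind_closure Ct (inf \<gamma> a)) ` \<Gamma>)))) a \<le> Ct \<Gamma>"

definition tangled_closure_rel :: "'s set \<Rightarrow> 's rel \<Rightarrow> 's set set \<Rightarrow> 's set" where
  "tangled_closure_rel S R \<Gamma> = \<Union>{a. a \<subseteq> S \<and> a \<subseteq> (\<Inter>\<gamma>\<in>\<Gamma>. R\<inverse> `` (\<gamma> \<inter> a))}"

text \<open>The powerset algebra of \<open>S\<close> has carrier \<open>Pow S\<close>, with complement taken relative to \<open>S\<close>;
  \<open>S\<close> is a set rather than a type because it is existentially quantified and may be empty
  (for the one-element Boolean algebra).\<close>

definition boolean_iso_powerset :: "'s set \<Rightarrow> ('a::boolean_algebra \<Rightarrow> 's set) \<Rightarrow> bool" where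
  "boolean_iso_powerset S f \<longleftrightarrow>
     bij_betw f UNIV (Pow S) \<and>
     (\<forall>a b. f (inf a b) = f a \<inter> f b) \<and>
     (\<forall>a b. f (sup a b) = f a \<union> f b) \<and>
     (\<forall>a. f (- a) = S - f a) \<and>
     f bot = {} \<and>
     f top = S"

definition tangled_iso_powerset ::
  "('a::boolean_algebra set \<Rightarrow> 'a) \<Rightarrow> 's set \<Rightarrow> 's rel \<Rightarrow> ('a \<Rightarrow> 's set) \<Rightarrow> bool" where
  "tangled_iso_powerset Ct S R f \<longleftrightarrow>
     boolean_iso_powerset S f \<and>
     (\<forall>\<Gamma>\<in>Pfin UNIV. f (Ct \<Gamma>) = tangled_closure_rel S R (f ` \<Gamma>))"

end

theory Submission
  imports Defs
begin

text \<open>Represent each element of the algebra by the set of atoms below it, and relate atoms by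
  \<open>x R y\<close> iff \<open>x \<le> C y\<close>. Additivity of \<open>C\<close> turns \<open>C\<close> into \<open>R\<inverse>\<close> under this representation. By
  (Fix) and (Ind), \<open>C\<^sup>t \<Gamma>\<close> is the greatest \<open>a\<close> with \<open>a \<le> C (\<gamma> \<and> a)\<close> for all \<open>\<gamma> \<in> \<Gamma>\<close>, so it is
  determined by \<open>C\<close> and the order, and every Boolean isomorphism that carries \<open>C\<close> to \<open>R\<inverse>\<close> also
  carries \<open>C\<^sup>t\<close> to the tangled closure of \<open>R\<close>.\<close>

definition atom :: "'a::order_bot \<Rightarrow> bool" where
  "atom x \<longleftrightarrow> x \<noteq> bot \<and> (\<forall>y\<le>x. y = bot \<or> y = x)"

definition atoms_below :: "'a::order_bot \<Rightarrow> 'a set" where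
  "atoms_below a = {x. atom x \<and> x \<le> a}"

lemma atom_not_le_bot: "atom x \<Longrightarrow> \<not> x \<le> bot"
  by (simp add: atom_def bot_unique)

lemma atom_le_atom_iff: "atom x \<Longrightarrow> atom y \<Longrightarrow> x \<le> y \<longleftrightarrow> x = y"
  by (auto simp: atom_def)

lemma atom_le_sup_iff:
  fixes x :: "'a::{distrib_lattice,bounded_lattice_bot}"
  assumes "atom x"
  shows "x \<le> sup a b \<longleftrightarrow> x \<le> a \<or> x \<le> b"
proof
  assume "x \<le> sup a b"
  then have sup_eq: "sup (inf x a) (inf x b) = x"
    by (simp add: inf_sup_distrib1[symmetric] inf.absorb1)
  have "inf x a = bot \<or> inf x a = x"
    using assms by (simp add: atom_def)
  then show "x \<le> a \<or> x \<le> b"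
  proof
    assume "inf x a = bot"
    with sup_eq have "inf x b = x" by simp
    then show ?thesis by (simp add: inf.absorb_iff1)
  next
    assume "inf x a = x"
    then show ?thesis by (simp add: inf.absorb_iff1)
  qed
qed (auto intro: le_supI1 le_supI2)

lemma atom_le_Sup_fin_iff:
  fixes x :: "'a::{distrib_lattice,bounded_lattice_bot}"
  assumes "atom x" "finite A" "A \<noteq> {}"
  shows "x \<le> Sup_fin A \<longleftrightarrow> (\<exists>a\<in>A. x \<le> a)"
  using assms(2,3)
  by (induction A rule: finite_ne_induct) (simp_all add: atom_le_sup_iff[OF assms(1)])

lemma atom_le_compl_iff:
  fixes x :: "'a::boolean_algebra"
  assumes "atom x"
  shows "x \<le> - a \<longleftrightarrow> \<not> x \<le> a"
proof
  assume "x \<le> - a"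
  show "\<not> x \<le> a"
  proof
    assume "x \<le> a"
    from this \<open>x \<le> - a\<close> have "x \<le> inf a (- a)" by (rule inf_greatest)
    with atom_not_le_bot[OF assms] show False by simp
  qed
next
  have "x \<le> sup a (- a)" by simp
  then show "\<not> x \<le> a \<Longrightarrow> x \<le> - a"
    unfolding atom_le_sup_iff[OF assms] by blast
qed

lemma atoms_below_bot: "atoms_below bot = {}"
  by (simp add: atoms_below_def atom_not_le_bot)

lemma atoms_below_top: "atoms_below (top :: 'a::{order_bot,order_top}) = Collect atom"
  by (simp add: atoms_below_def)

lemma atoms_below_inf:
  fixes a b :: "'a::{semilattice_inf,order_bot}"
  shows "atoms_below (inf a b) = atoms_below a \<inter> atoms_below b"
  by (auto simp: atoms_below_def)

lemma atoms_below_sup: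
  fixes a b :: "'a::{distrib_lattice,bounded_lattice_bot}"
  shows "atoms_below (sup a b) = atoms_below a \<union> atoms_below b"
  by (auto simp: atoms_below_def atom_le_sup_iff)

lemma atoms_below_compl:
  fixes a :: "'a::boolean_algebra"
  shows "atoms_below (- a) = Collect atom - atoms_below a"
  by (auto simp: atoms_below_def atom_le_compl_iff)

text \<open>\<open>Sup_fin {}\<close> is unspecified, hence the inserted \<open>bot\<close>.\<close>

lemma atoms_below_Sup_fin_atoms:
  fixes T :: "'a::{distrib_lattice,bounded_lattice_bot} set"
  assumes "finite T" "T \<subseteq> Collect atom"
  shows "atoms_below (Sup_fin (insert bot T)) = T"
proof -
  have "x \<le> Sup_fin (insert bot T) \<longleftrightarrow> x \<in> T" if x: "atom x" for x
  proof -
    have "x \<le> Sup_fin (insert bot T) \<longleftrightarrow> (\<exists>y\<in>T. x \<le> y)"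
      using atom_le_Sup_fin_iff[OF x, of "insert bot T"] assms(1) atom_not_le_bot[OF x] by simp
    also have "\<dots> \<longleftrightarrow> x \<in> T"
      using x assms(2) by (auto simp: atom_le_atom_iff)
    finally show ?thesis .
  qed
  with assms(2) show ?thesis
    by (auto simp: atoms_below_def)
qed

lemma ex_atom_below:
  fixes a :: "'a::{order_bot,finite}"
  assumes "a \<noteq> bot"
  shows "\<exists>x. atom x \<and> x \<le> a"
proof -
  obtain m where m: "m \<noteq> bot" "m \<le> a" "\<And>y. y \<noteq> bot \<Longrightarrow> y \<le> a \<Longrightarrow> y \<le> m \<Longrightarrow> m = y"
    using finite_has_minimal[of "{x. x \<noteq> bot \<and> x \<le> a}"] assms by auto
  then have "atom m"
    unfolding atom_def by (metis order.trans)
  with m(2) show ?thesis by blast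
qed

lemma atoms_below_subset_iff:
  fixes a b :: "'a::{boolean_algebra,finite}"
  shows "atoms_below a \<subseteq> atoms_below b \<longleftrightarrow> a \<le> b"
proof
  assume "atoms_below a \<subseteq> atoms_below b"
  then have "atoms_below (inf a (- b)) = {}"
    by (auto simp: atoms_below_inf atoms_below_compl)
  then have "inf a (- b) = bot"
    using ex_atom_below[of "inf a (- b)"] by (auto simp: atoms_below_def)
  then show "a \<le> b"
    by (simp add: inf_shunt)
qed (auto simp: atoms_below_def)

lemma inj_atoms_below: "inj (atoms_below :: 'a::{boolean_algebra,finite} \<Rightarrow> 'a set)"
  by (rule injI) (metis antisym atoms_below_subset_iff order_refl)

lemma boolean_iso_powerset_atoms_below:
  "boolean_iso_powerset (Collect atom)
     (atoms_below :: 'a::{boolean_algebra,finite} \<Rightarrow> 'a set)"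
proof -
  have "range (atoms_below :: 'a \<Rightarrow> 'a set) = Pow (Collect atom)"
  proof (intro equalityI subsetI)
    fix T :: "'a set"
    assume "T \<in> Pow (Collect atom)"
    then have "atoms_below (Sup_fin (insert bot T)) = T"
      by (simp add: atoms_below_Sup_fin_atoms)
    then show "T \<in> range atoms_below"
      by (metis rangeI)
  qed (auto simp: atoms_below_def)
  with inj_atoms_below have "bij_betw (atoms_below :: 'a \<Rightarrow> 'a set) UNIV (Pow (Collect atom))"
    by (rule bij_betw_imageI)
  then show ?thesis
    by (simp add: boolean_iso_powerset_def atoms_below_inf atoms_below_sup
        atoms_below_compl atoms_below_bot atoms_below_top)
qed

definition atom_rel :: "('a::order_bot \<Rightarrow> 'a) \<Rightarrow> 'a rel" where
  "atom_rel h = {(x, y). atom x \<and> atom y \<and> x \<le> h y}"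

lemma atoms_below_additive:
  fixes h :: "'a::{boolean_algebra,finite} \<Rightarrow> 'a"
  assumes h_sup: "\<And>a b. h (sup a b) = sup (h a) (h b)" and h_bot: "h bot = bot"
  shows "atoms_below (h a) = (atom_rel h)\<inverse> `` atoms_below a"
proof -
  let ?A = "insert bot (atoms_below a)"
  have "atoms_below (Sup_fin ?A) = atoms_below a"
    by (rule atoms_below_Sup_fin_atoms) (auto simp: atoms_below_def)
  then have "Sup_fin ?A = a"
    by (rule injD[OF inj_atoms_below])
  then have h_eq: "h a = Sup_fin (h ` ?A)"
    using Sup_fin.hom_commute[of h ?A] h_sup by simp
  have "x \<le> h a \<longleftrightarrow> (\<exists>y\<in>atoms_below a. x \<le> h y)" if "atom x" for x
    unfolding h_eq using that by (simp add: atom_le_Sup_fin_iff h_bot atom_not_le_bot)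
  then show ?thesis
    by (auto simp: atoms_below_def atom_rel_def)
qed

lemma closure_operator_mono:
  assumes "closure_operator C" and "a \<le> b"
  shows "C a \<le> C b"
  using assms unfolding closure_operator_def by (metis sup.absorb_iff2)

lemma preorder_on_atom_rel:
  assumes "closure_operator C"
  shows "preorder_on (Collect atom) (atom_rel C)"
proof -
  have "x \<le> C z" if "x \<le> C y" "y \<le> C z" for x y z
  proof -
    note \<open>x \<le> C y\<close>
    also have "C y \<le> C (C z)"
      using assms \<open>y \<le> C z\<close> by (rule closure_operator_mono)
    also have "C (C z) = C z"
      using assms by (simp add: closure_operator_def)
    finally show ?thesis .
  qed
  then have "trans (atom_rel C)"
    unfolding trans_def atom_rel_def by blast
  moreover have "refl_on (Collect atom) (atom_rel C)"
    using assms by (auto simp: refl_on_def atom_rel_def closure_operator_def)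
  ultimately show ?thesis
    by (auto simp: preorder_on_def atom_rel_def)
qed

definition tangled_postfixed :: "('a::semilattice_inf \<Rightarrow> 'a) \<Rightarrow> 'a set \<Rightarrow> 'a \<Rightarrow> bool" where
  "tangled_postfixed C \<Gamma> a \<longleftrightarrow> (\<forall>\<gamma>\<in>\<Gamma>. a \<le> C (inf \<gamma> a))"

lemma tangled_closure_rel_eq_Union_postfixed:
  "tangled_closure_rel S R \<Gamma> = \<Union>{X \<in> Pow S. tangled_postfixed ((``) (R\<inverse>)) \<Gamma> X}"
  by (simp add: tangled_closure_rel_def tangled_postfixed_def le_INF_iff)

lemma boolean_iso_powerset_subset_iff:
  assumes "boolean_iso_powerset S f"
  shows "f a \<subseteq> f b \<longleftrightarrow> a \<le> b"
proof -
  have "inj f" and "f (inf a b) = f a \<inter> f b"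
    using assms by (auto simp: boolean_iso_powerset_def bij_betw_def)
  then show ?thesis
    by (metis inf.absorb_iff1 injD)
qed

context tangled_closure_algebra
begin

lemma tangled_postfixed_Ct:
  assumes "\<Gamma> \<in> Pfin UNIV"
  shows "tangled_postfixed (ind_closure Ct) \<Gamma> (Ct \<Gamma>)"
  using Fix[OF assms] assms
  by (auto simp: tangled_postfixed_def Pfin_def intro: order.trans Inf_fin.coboundedI)

lemma tangled_postfixed_le_Ct:
  assumes \<Gamma>: "\<Gamma> \<in> Pfin UNIV" and a: "tangled_postfixed (ind_closure Ct) \<Gamma> a"
  shows "a \<le> Ct \<Gamma>"
proof -
  let ?b = "Inf_fin ((\<lambda>\<gamma>. ind_closure Ct (inf \<gamma> a)) ` \<Gamma>)"
  have "a \<le> ?b"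
    using \<Gamma> a by (intro Inf_fin.boundedI) (auto simp: Pfin_def tangled_postfixed_def)
  then have "bimp a ?b = top"
    unfolding bimp_def by (metis sup_shunt double_compl)
  moreover have "ind_interior Ct top = top"
    using closure by (simp add: ind_interior_def closure_operator_def ind_closure_def)
  ultimately show ?thesis
    using Ind[OF \<Gamma>, of a] by simp
qed

lemma tangled_iso_powersetI:
  assumes f: "boolean_iso_powerset S f"
    and f_closure: "\<And>a. f (ind_closure Ct a) = R\<inverse> `` f a"
  shows "tangled_iso_powerset Ct S R f"
proof -
  have f_inf: "f (inf a b) = f a \<inter> f b" and range_f: "range f = Pow S" for a b
    using f by (auto simp: boolean_iso_powerset_def bij_betw_def)
  have postfixed_iff:
    "tangled_postfixed ((``) (R\<inverse>)) (f ` \<Gamma>) (f a) \<longleftrightarrow> tangled_postfixed (ind_closure Ct) \<Gamma> a"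
    for \<Gamma> a
    by (simp add: tangled_postfixed_def f_inf[symmetric] f_closure[symmetric]
        boolean_iso_powerset_subset_iff[OF f])
  have "f (Ct \<Gamma>) = tangled_closure_rel S R (f ` \<Gamma>)" if \<Gamma>: "\<Gamma> \<in> Pfin UNIV" for \<Gamma>
  proof -
    have "\<Union>(f ` {a. tangled_postfixed (ind_closure Ct) \<Gamma> a}) = f (Ct \<Gamma>)"
    proof (rule cSup_eq_maximum)
      show "f (Ct \<Gamma>) \<in> f ` {a. tangled_postfixed (ind_closure Ct) \<Gamma> a}"
        using tangled_postfixed_Ct[OF \<Gamma>] by simp
    next
      fix X
      assume "X \<in> f ` {a. tangled_postfixed (ind_closure Ct) \<Gamma> a}"
      then obtain a where "X = f a" and "tangled_postfixed (ind_closure Ct) \<Gamma> a"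
        by blast
      then show "X \<subseteq> f (Ct \<Gamma>)"
        using tangled_postfixed_le_Ct[OF \<Gamma>] by (simp add: boolean_iso_powerset_subset_iff[OF f])
    qed
    moreover have "{X \<in> Pow S. tangled_postfixed ((``) (R\<inverse>)) (f ` \<Gamma>) X}
        = f ` {a. tangled_postfixed (ind_closure Ct) \<Gamma> a}"
      unfolding range_f[symmetric] by (auto simp: postfixed_iff)
    ultimately show ?thesis
      by (simp add: tangled_closure_rel_eq_Union_postfixed)
  qed
  with f show ?thesis
    by (simp add: tangled_iso_powerset_def)
qed

end

theorem theorem3p1:
  fixes Ct :: "'a::{boolean_algebra,finite} set \<Rightarrow> 'a"
  assumes "tangled_closure_algebra Ct"
  shows "\<exists>(S :: 'a set) (R :: 'a rel) f.
           finite S \<and> preorder_on S R \<and> tangled_iso_powerset Ct S R f"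
proof -
  interpret tangled_closure_algebra Ct by fact
  let ?C = "ind_closure Ct"
  have "atoms_below (?C a) = (atom_rel ?C)\<inverse> `` atoms_below a" for a
    using closure by (intro atoms_below_additive) (simp_all add: closure_operator_def)
  with boolean_iso_powerset_atoms_below
  have "tangled_iso_powerset Ct (Collect atom) (atom_rel ?C) atoms_below"
    by (rule tangled_iso_powersetI)
  moreover have "preorder_on (Collect atom) (atom_rel ?C)"
    using closure by (rule preorder_on_atom_rel)
  moreover have "finite (Collect atom :: 'a set)" by simp
  ultimately show ?thesis by blast
qed

end
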